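(* For $i,j\in\{1,\dots,n\}$ let $a_{ij}:[0,\infty)\to[0,\infty)$ be piecewise constant right-continuous functions taking values in a finite set, with $a_{ii}(t)=0$ for all $i,t$, and put $A(t)=[a_{ij}(t)]$. Suppose that $\mathcal{G}(A(t))$ is undirected and connected for all $t\ge0$. Let $\alpha_{ij}(t)$ be piecewise constant right-continuous functions of time taking values in a finite set such that $\alpha_{ij}(t)=\alpha_{ji}(t)$ and $0<\alpha_{ij}(t)<1$ for all $i,j,t$. Then the system $$\dot x_i(t)=\sum_{j=1}^n a_{ij}(t)\operatorname{sig}\big(x_j(t)-x_i(t)\big)^{\alpha_{ij}(t)},\qquad i=1,\dots,n,$$ with $x_i(t)\in\mathbb{R}$, solves the finite-time average-consensus problem: for every initial state $x(0)\in\mathbb{R}^n$ and every solution on $[0,\infty)$ with that initial state there is a time $t^*$ such that $x_j(t)=\frac1n\sum_{i=1}^n x_i(0)$ for all $t\ge t^*$ and all $j$.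
   Context: For $r\in\mathbb{R}$ and $\alpha>0$, $\operatorname{sig}(r)^\alpha:=\operatorname{sign}(r)|r|^\alpha$, with $\operatorname{sign}(0)=0$. For a nonnegative matrix $A=[a_{ij}]$, the weighted directed graph $\mathcal{G}(A)$ has vertices $v_1,\dots,v_n$ and an edge $(v_i,v_j)$ if and only if $a_{ji}>0$; it is undirected if $A^T=A$, and an undirected graph is connected if any two distinct vertices are joined by a path. Piecewise constant functions on $[0,\infty)$ have finitely many jumps on each bounded interval. A solution is a continuous function $x:[0,\infty)\to\mathbb{R}^n$ satisfying the differential equation on each interval between consecutive switching times (with one-sided derivatives at the switching times). *)

theory Defs
  imports "HOL-Analysis.Analysis" "Graph_Theory.Arc_Walk"
begin

definition sig :: "real \<Rightarrow> real \<Rightarrow> real" where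
  "sig r \<alpha> = sgn r * \<bar>r\<bar> powr \<alpha>"

(* Note the transposition: (i, j) is an arc iff the (j, i) entry is positive. *)
definition matrix_digraph :: "real ^ 'n ^ 'n \<Rightarrow> ('n::finite, 'n \<times> 'n) pre_digraph" where
  "matrix_digraph A = \<lparr>verts = UNIV, arcs = {(i, j). A $ j $ i > 0}, tail = fst, head = snd\<rparr>"

(* Undirectedness is a property of the weights, not only of the arc set. *)
definition undirected_matrix_digraph :: "real ^ 'n ^ 'n \<Rightarrow> bool" where
  "undirected_matrix_digraph A \<longleftrightarrow> transpose A = A"

(* Intended for undirected graphs; on a general digraph it demands directed paths. *)
definition path_connected_digraph :: "('a, 'b) pre_digraph \<Rightarrow> bool" where
  "path_connected_digraph G \<longleftrightarrow>
     (\<forall>u \<in> verts G. \<forall>v \<in> verts G. u \<noteq> v \<longrightarrow> (\<exists>p. pre_digraph.apath G u p v))"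

(* Functions of time are total on the reals; only their values on {0..} matter. *)
definition piecewise_constant :: "(real \<Rightarrow> 'a) \<Rightarrow> bool" where
  "piecewise_constant f \<longleftrightarrow>
     (\<forall>T\<ge>0. \<exists>S. finite S \<and>
        (\<forall>s t. 0 \<le> s \<and> t \<le> T \<and> {s<..<t} \<inter> S = {} \<longrightarrow> f constant_on {s<..<t}))"

definition switching_signal :: "(real \<Rightarrow> real) \<Rightarrow> bool" where
  "switching_signal f \<longleftrightarrow>
     piecewise_constant f \<and> (\<forall>t\<ge>0. continuous (at_right t) f) \<and> finite (f ` {0..})"

definition switching_times ::
  "('n \<Rightarrow> 'n \<Rightarrow> real \<Rightarrow> real) \<Rightarrow> ('n \<Rightarrow> 'n \<Rightarrow> real \<Rightarrow> real) \<Rightarrow> real set" where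
  "switching_times a \<alpha> = {t. t > 0 \<and> (\<exists>i j. \<not> isCont (a i j) t \<or> \<not> isCont (\<alpha> i j) t)}"

definition consensus_field ::
  "('n \<Rightarrow> 'n \<Rightarrow> real) \<Rightarrow> ('n \<Rightarrow> 'n \<Rightarrow> real) \<Rightarrow> real ^ 'n \<Rightarrow> real ^ 'n::finite" where
  "consensus_field w p x = (\<chi> i. \<Sum>j\<in>UNIV. w i j * sig (x $ j - x $ i) (p i j))"

(* For right-continuous piecewise constant coefficients, if no switching time lies in {s<..<t}
   then the coefficients on {s..<t} are those at s.  The equation with these coefficients is
   required on all of {s..t}; the derivative within {s..t} is one-sided at s and at t, so at a
   switching time t the left derivative uses the coefficients in force before t. *)
definition consensus_solution ::
  "('n::finite \<Rightarrow> 'n \<Rightarrow> real \<Rightarrow> real) \<Rightarrow> ('n \<Rightarrow> 'n \<Rightarrow> real \<Rightarrow> real) \<Rightarrow> (real \<Rightarrow> real ^ 'n) \<Rightarrow> bool"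
  where
  "consensus_solution a \<alpha> x \<longleftrightarrow>
     continuous_on {0..} x \<and>
     (\<forall>s t. 0 \<le> s \<and> s < t \<and> {s<..<t} \<inter> switching_times a \<alpha> = {} \<longrightarrow>
        (\<forall>u\<in>{s..t}. (x has_vector_derivative
            consensus_field (\<lambda>i j. a i j s) (\<lambda>i j. \<alpha> i j s) (x u)) (at u within {s..t})))"

definition solves_finite_time_average_consensus ::
  "('n::finite \<Rightarrow> 'n \<Rightarrow> real \<Rightarrow> real) \<Rightarrow> ('n \<Rightarrow> 'n \<Rightarrow> real \<Rightarrow> real) \<Rightarrow> bool" where
  "solves_finite_time_average_consensus a \<alpha> \<longleftrightarrow>
     (\<forall>x0 x. consensus_solution a \<alpha> x \<and> x 0 = x0 \<longrightarrow>
        (\<exists>t'\<ge>0. \<forall>t\<ge>t'. \<forall>j. x t $ j = (\<Sum>i\<in>UNIV. x0 $ i) / real CARD('n)))"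

end

theory Submission
  imports Defs
begin

text \<open>
  The squared distance \<open>V\<close> of the state from consensus is a Lyapunov function whose decay
  is faster than exponential near zero.  Since weights and exponents are symmetric, the interaction
  terms are antisymmetric.  Hence the sum of the coordinates is conserved, so the average is the only
  possible limit, and summation by parts gives
  \<open>V' = - \<Sum> a i j * \<bar>x j - x i\<bar> powr (1 + \<alpha> i j)\<close>
  (lemma \<open>disagreement_dissipation\<close>).

  Connectedness turns this into an inequality for \<open>V\<close> alone.  A path between two vertices has
  fewer than \<open>n\<close> edges, so if every edge difference were small, then so would be all pairwise
  differences, and with them all deviations from the mean.  Some edge therefore has
  \<open>(x j - x i)^2 \<ge> V / n^3\<close> (lemma \<open>connected_long_edge\<close>).  The coefficients take finitely
  many values, so positive weights are at least some \<open>m > 0\<close> and exponents are at most some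
  \<open>\<beta> < 1\<close>.  As \<open>V\<close> never exceeds its initial value, the varying exponents can be replaced
  by \<open>\<beta>\<close> at the cost of a constant, which gives \<open>V' \<le> - C * V powr ((1 + \<beta>) / 2)\<close>
  with one \<open>C > 0\<close> for all graphs that occur (lemma \<open>disagreement_decay\<close>).

  Because the power is below 1, a suitable positive power of \<open>V\<close> decreases at least linearly as
  long as \<open>V > 0\<close>, so \<open>V\<close> reaches zero in finite time and stays there
  (lemma \<open>finite_time_extinction\<close>).  Switching does no harm: on bounded intervals the
  derivative can be missing at finitely many points only, and the solution is continuous there.
\<close>

section \<open>Monotonicity and extinction under piecewise differential inequalities\<close>

text \<open>
  The derivative, set to zero at the exceptional points, is still integrable in the sense of
  Henstock and Kurzweil, and its integral is the increment of the continuous function.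
\<close>

lemma nonincreasing_except_finite:
  fixes f :: "real \<Rightarrow> real"
  assumes "a \<le> b" and cont: "continuous_on {a..b} f" and "finite S"
    and deriv: "\<And>t. t \<in> {a<..<b} - S \<Longrightarrow> \<exists>D\<le>0. (f has_real_derivative D) (at t)"
  shows "f b \<le> f a"
proof -
  obtain D where D: "\<And>t. t \<in> {a<..<b} - S \<Longrightarrow> D t \<le> 0 \<and> (f has_real_derivative D t) (at t)"
    using deriv by metis
  define D' where "D' t = (if t \<in> {a<..<b} - S then D t else 0)" for t
  have int: "(D' has_integral (f b - f a)) {a..b}"
  proof (rule fundamental_theorem_of_calculus_interior_strong)
    show "(f has_vector_derivative D' t) (at t)" if "t \<in> {a<..<b} - S" for t
      using D[OF that] that
      by (simp add: D'_def has_real_derivative_iff_has_vector_derivative)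
  qed (use assms in auto)
  have "D' t \<le> 0" for t
    using D by (simp add: D'_def)
  then have "f b - f a \<le> 0"
    by (rule has_integral_le[OF int has_integral_0])
  then show ?thesis by simp
qed

text \<open>
  While \<open>V\<close> is positive, \<open>V powr (1 - \<theta>)\<close> has derivative at most
  \<open>- C * (1 - \<theta>)\<close>, so it would become negative if \<open>V\<close> stayed positive for too long.
  Monotonicity keeps \<open>V\<close> at zero afterwards.
\<close>

lemma finite_time_extinction:
  fixes V :: "real \<Rightarrow> real"
  assumes cont: "continuous_on {0..} V"
    and nonneg: "\<And>t. t \<ge> 0 \<Longrightarrow> V t \<ge> 0"
    and mono: "\<And>s t. 0 \<le> s \<Longrightarrow> s \<le> t \<Longrightarrow> V t \<le> V s"
    and "C > 0" "0 < \<theta>" "\<theta> < 1"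
    and deriv: "\<And>T. \<exists>S. finite S \<and>
      (\<forall>t\<in>{0<..<T} - S. \<exists>D. (V has_real_derivative D) (at t) \<and> D \<le> - C * V t powr \<theta>)"
  shows "\<exists>t'\<ge>0. \<forall>t\<ge>t'. V t = 0"
proof -
  \<comment> \<open>the time at which the linear upper bound for \<open>V powr (1 - \<theta>)\<close> vanishes\<close>
  define T where "T = V 0 powr (1 - \<theta>) / (C * (1 - \<theta>))"
  have k: "C * (1 - \<theta>) > 0" using assms by simp
  have T: "T \<ge> 0" using k by (simp add: T_def)
  have "V T = 0"
  proof (rule ccontr)
    assume "V T \<noteq> 0"
    then have pos: "V t > 0" if "0 \<le> t" "t \<le> T" for t
      using mono[OF that] nonneg[OF T] by linarith
    obtain S where S: "finite S" and S_deriv: "\<And>t. t \<in> {0<..<T} - S \<Longrightarrow>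
        \<exists>D. (V has_real_derivative D) (at t) \<and> D \<le> - C * V t powr \<theta>"
      using deriv[of T] by blast
    define W where "W t = V t powr (1 - \<theta>) + C * (1 - \<theta>) * t" for t
    have "W T \<le> W 0"
    proof (rule nonincreasing_except_finite[OF T _ S])
      show "continuous_on {0..T} W"
        unfolding W_def
        by (intro continuous_intros continuous_on_subset[OF cont]) (use pos in force)+
    next
      fix t assume t: "t \<in> {0<..<T} - S"
      have Vt: "V t > 0" using pos t by simp
      obtain D where D: "(V has_real_derivative D) (at t)" "D \<le> - C * V t powr \<theta>"
        using S_deriv[OF t] by blast
      let ?D = "(1 - \<theta>) * V t powr (- \<theta>) * D + C * (1 - \<theta>)"
      have "((\<lambda>s. V s powr (1 - \<theta>)) has_real_derivative (1 - \<theta>) * V t powr (- \<theta>) * D) (at t)"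
        using DERIV_chain2[OF has_real_derivative_powr[OF Vt, of "1 - \<theta>"] D(1)] by simp
      then have "(W has_real_derivative ?D) (at t)"
        unfolding W_def by (rule DERIV_add) (auto intro!: derivative_eq_intros)
      moreover have "?D \<le> 0"
      proof -
        have "V t powr (- \<theta>) * D \<le> V t powr (- \<theta>) * (- C * V t powr \<theta>)"
          using D(2) by (rule mult_left_mono) simp
        also have "\<dots> = - C"
          using Vt by (simp add: powr_minus field_simps)
        finally have "(1 - \<theta>) * (V t powr (- \<theta>) * D) \<le> (1 - \<theta>) * (- C)"
          using \<open>\<theta> < 1\<close> by (intro mult_left_mono) auto
        then show ?thesis by (simp add: algebra_simps)
      qed
      ultimately show "\<exists>D\<le>0. (W has_real_derivative D) (at t)" by blast
    qed
    moreover have "V T powr (1 - \<theta>) > 0" using pos[of T] T by simp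
    moreover have "C * (1 - \<theta>) * T = V 0 powr (1 - \<theta>)"
      unfolding T_def times_divide_eq_right
      by (rule nonzero_mult_div_cancel_left) (use k in linarith)
    ultimately show False by (simp add: W_def)
  qed
  then have "V t = 0" if "t \<ge> T" for t
    using mono[OF T that] nonneg[of t] T that by simp
  with T show ?thesis by blast
qed

section \<open>Antisymmetric sums and the dissipation of the disagreement\<close>

text \<open>
  Exchanging the names of the indices lets both endpoints of an edge contribute to the same term.
  The choice \<open>g = 1\<close> gives conservation of the sum, and \<open>g i = y i - c\<close> gives dissipation.
\<close>

lemma antisymmetric_summation_by_parts:
  fixes F :: "'n::finite \<Rightarrow> 'n \<Rightarrow> real"
  assumes "\<And>i j. F i j = - F j i"
  shows "2 * (\<Sum>i\<in>UNIV. g i * (\<Sum>j\<in>UNIV. F i j)) = - (\<Sum>i\<in>UNIV. \<Sum>j\<in>UNIV. (g j - g i) * F i j)"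
proof -
  have "(\<Sum>i\<in>UNIV. \<Sum>j\<in>UNIV. g j * F i j) = (\<Sum>i\<in>UNIV. \<Sum>j\<in>UNIV. g i * F j i)"
    by (rule sum.swap)
  also have "\<dots> = (\<Sum>i\<in>UNIV. \<Sum>j\<in>UNIV. - (g i * F i j))"
  proof (intro sum.cong refl)
    show "g i * F j i = - (g i * F i j)" for i j
      using assms[of i j] by simp
  qed
  finally show ?thesis
    by (simp add: left_diff_distrib sum_subtractf sum_negf sum_distrib_left)
qed

lemma sig_minus: "sig (- r) p = - sig r p"
  by (simp add: sig_def sgn_minus)

lemma mult_sig: "r * sig r p = \<bar>r\<bar> powr (1 + p)"
proof -
  have "r * sig r p = \<bar>r\<bar> * \<bar>r\<bar> powr p"
    unfolding sig_def by (simp add: abs_sgn)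
  then show ?thesis
    by (cases "r = 0") (simp_all add: powr_add)
qed

lemma disagreement_dissipation:
  fixes w p :: "'n::finite \<Rightarrow> 'n \<Rightarrow> real" and y :: "'n \<Rightarrow> real"
  assumes w: "\<And>i j. w i j = w j i" and p: "\<And>i j. p i j = p j i"
  shows "(\<Sum>i\<in>UNIV. \<Sum>j\<in>UNIV. w i j * sig (y j - y i) (p i j)) = 0" (is ?conserved)
    and "(\<Sum>i\<in>UNIV. 2 * (y i - c) * (\<Sum>j\<in>UNIV. w i j * sig (y j - y i) (p i j)))
       = - (\<Sum>i\<in>UNIV. \<Sum>j\<in>UNIV. w i j * \<bar>y j - y i\<bar> powr (1 + p i j))" (is ?dissipated)
proof -
  let ?F = "\<lambda>i j. w i j * sig (y j - y i) (p i j)"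
  have anti: "?F i j = - ?F j i" for i j
    using sig_minus[of "y i - y j" "p j i"] w[of i j] p[of i j] by simp
  show ?conserved
    using antisymmetric_summation_by_parts[of ?F "\<lambda>_. 1", OF anti] by simp
  have "(\<Sum>i\<in>UNIV. 2 * (y i - c) * (\<Sum>j\<in>UNIV. ?F i j))
      = 2 * (\<Sum>i\<in>UNIV. (y i - c) * (\<Sum>j\<in>UNIV. ?F i j))"
    by (subst sum_distrib_left) (simp only: mult.assoc)
  also have "\<dots> = - (\<Sum>i\<in>UNIV. \<Sum>j\<in>UNIV. (y j - y i) * ?F i j)"
    using antisymmetric_summation_by_parts[of ?F "\<lambda>i. y i - c", OF anti] by simp
  also have "\<dots> = - (\<Sum>i\<in>UNIV. \<Sum>j\<in>UNIV. w i j * \<bar>y j - y i\<bar> powr (1 + p i j))"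
    by (simp add: mult.left_commute[of "y _ - y _"] mult_sig)
  finally show ?dissipated .
qed

section \<open>Long edges in connected graphs\<close>

lemma awalk_oscillation:
  fixes y :: "'n::finite \<Rightarrow> real"
  assumes "pre_digraph.awalk (matrix_digraph A) u p v"
    and "\<And>i j. A $ j $ i > 0 \<Longrightarrow> \<bar>y j - y i\<bar> \<le> r"
  shows "\<bar>y v - y u\<bar> \<le> real (length p) * r"
  using assms(1)
proof (induction p arbitrary: u)
  case Nil
  then show ?case by (simp add: pre_digraph.awalk_def pre_digraph.cas.simps)
next
  case (Cons e p)
  obtain i j where e: "e = (i, j)" by force
  have "i = u" "A $ j $ i > 0" "pre_digraph.awalk (matrix_digraph A) j p v"
    using Cons.prems
    by (auto simp: e pre_digraph.awalk_def pre_digraph.cas.simps matrix_digraph_def)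
  then show ?case
    using Cons.IH[of j] assms(2)[of j i] by (simp add: algebra_simps)
qed

text \<open>
  The connecting walk may be taken without repeated vertices, which bounds its length.
\<close>

lemma connected_oscillation:
  fixes y :: "'n::finite \<Rightarrow> real"
  assumes conn: "path_connected_digraph (matrix_digraph A)" and "r \<ge> 0"
    and edges: "\<And>i j. A $ j $ i > 0 \<Longrightarrow> \<bar>y j - y i\<bar> \<le> r"
  shows "\<bar>y v - y u\<bar> \<le> (real CARD('n) - 1) * r"
proof (cases "u = v")
  case True
  then show ?thesis using \<open>r \<ge> 0\<close> by simp
next
  case False
  let ?G = "matrix_digraph A"
  obtain p where p: "pre_digraph.apath ?G u p v"
    using conn False by (auto simp: path_connected_digraph_def matrix_digraph_def)
  then have "distinct (pre_digraph.awalk_verts ?G u p)"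
    by (simp add: pre_digraph.apath_def)
  then have "length (pre_digraph.awalk_verts ?G u p) \<le> CARD('n)"
    by (metis card_mono distinct_card finite top_greatest)
  moreover have "length (pre_digraph.awalk_verts ?G u p) = Suc (length p)"
    by (induction p arbitrary: u) (auto simp: pre_digraph.awalk_verts.simps)
  ultimately have "real (length p) \<le> real CARD('n) - 1" by linarith
  moreover have "\<bar>y v - y u\<bar> \<le> real (length p) * r"
    using p edges by (intro awalk_oscillation) (auto simp: pre_digraph.apath_def)
  ultimately show ?thesis
    using mult_right_mono[OF _ \<open>r \<ge> 0\<close>] by (meson order_trans)
qed

text \<open>
  The deviation of \<open>y i\<close> from the mean \<open>c\<close> is the average of the differences
  \<open>y i - y j\<close>.  If all edge differences were at most \<open>r\<close>, every deviation would thus be at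
  most \<open>(n - 1) * r\<close> and the sum of squares at most \<open>n * (n - 1)^2 * r^2 < n^3 * r^2\<close>; this
  strict inequality is the reason for the constant \<open>n^3\<close>.  With a single
  vertex the sum of squares is zero, so it has to be assumed positive to produce an edge.
\<close>

lemma connected_long_edge:
  fixes y :: "'n::finite \<Rightarrow> real"
  assumes conn: "path_connected_digraph (matrix_digraph A)"
    and mean: "(\<Sum>i\<in>UNIV. y i) = real CARD('n) * c"
    and pos: "(\<Sum>i\<in>UNIV. (y i - c)\<^sup>2) > 0"
  shows "\<exists>i j. A $ j $ i > 0 \<and> (\<Sum>i\<in>UNIV. (y i - c)\<^sup>2) / real CARD('n) ^ 3 \<le> (y j - y i)\<^sup>2"
proof (rule ccontr)
  assume none: "\<nexists>i j. A $ j $ i > 0 \<and> (\<Sum>i\<in>UNIV. (y i - c)\<^sup>2) / real CARD('n) ^ 3 \<le> (y j - y i)\<^sup>2"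
  define n where "n = real CARD('n)"
  define V where "V = (\<Sum>i\<in>UNIV. (y i - c)\<^sup>2)"
  define r where "r = sqrt (V / n ^ 3)"
  have n: "n \<ge> 1" by (simp add: n_def Suc_leI)
  have V: "V > 0" using pos by (simp add: V_def)
  have r: "r > 0" and r2: "r\<^sup>2 = V / n ^ 3" using n V by (auto simp: r_def)
  have edges: "\<bar>y j - y i\<bar> \<le> r" if "A $ j $ i > 0" for i j
  proof -
    have "(y j - y i)\<^sup>2 \<le> r\<^sup>2"
      using none that unfolding r2 V_def n_def by (meson linear)
    then show ?thesis using r by (simp add: abs_le_square_iff[symmetric])
  qed
  have osc: "\<bar>y v - y u\<bar> \<le> (n - 1) * r" for u v
    using connected_oscillation[OF conn less_imp_le[OF r] edges] by (simp add: n_def)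
  have dev: "(y i - c)\<^sup>2 \<le> ((n - 1) * r)\<^sup>2" for i
  proof -
    have "n * \<bar>y i - c\<bar> = \<bar>\<Sum>j\<in>UNIV. y i - y j\<bar>"
      using n mean by (simp add: sum_subtractf n_def right_diff_distrib[symmetric] abs_mult)
    also have "\<dots> \<le> (\<Sum>j\<in>UNIV. \<bar>y i - y j\<bar>)" by (rule sum_abs)
    also have "\<dots> \<le> (\<Sum>j\<in>(UNIV::'n set). (n - 1) * r)" by (intro sum_mono osc)
    also have "\<dots> = n * ((n - 1) * r)" by (simp add: n_def)
    finally have "\<bar>y i - c\<bar> \<le> (n - 1) * r" using n by simp
    then show ?thesis by (metis abs_ge_zero power2_abs power_mono)
  qed
  have "V \<le> (\<Sum>i\<in>(UNIV::'n set). ((n - 1) * r)\<^sup>2)"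
    unfolding V_def by (intro sum_mono dev)
  also have "\<dots> = (n * (n - 1)\<^sup>2) * r\<^sup>2" by (simp add: n_def power_mult_distrib)
  also have "\<dots> < n ^ 3 * r\<^sup>2"
  proof (rule mult_strict_right_mono)
    have "(n - 1)\<^sup>2 < n\<^sup>2" using n by (intro power_strict_mono) auto
    then show "n * (n - 1)\<^sup>2 < n ^ 3" using n by (simp add: power3_eq_cube power2_eq_square)
  qed (use r in simp)
  also have "\<dots> = V" using n by (simp add: r2)
  finally show False by simp
qed

text \<open>
  One long edge already carries enough dissipation.  Dividing by the a priori bound \<open>K\<close> brings
  \<open>V / n^3\<close> into the unit interval, where a larger exponent gives a smaller power; this is what
  allows every \<open>p i j\<close> to be replaced by the common bound \<open>\<beta>\<close>.
\<close>

lemma disagreement_decay: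
  fixes w p :: "'n::finite \<Rightarrow> 'n \<Rightarrow> real" and y :: "'n \<Rightarrow> real"
  defines "V \<equiv> \<lambda>c. \<Sum>i\<in>UNIV. (y i - c)\<^sup>2"
  assumes conn: "path_connected_digraph (matrix_digraph (\<chi> i j. w i j))"
    and mean: "(\<Sum>i\<in>UNIV. y i) = real CARD('n) * c"
    and w: "\<And>i j. w i j \<ge> 0" "\<And>i j. w i j > 0 \<Longrightarrow> w i j \<ge> m" and "m \<ge> 0"
    and p: "\<And>i j. 0 < p i j" "\<And>i j. p i j \<le> \<beta>"
    and K: "K \<ge> 1" "V c / real CARD('n) ^ 3 \<le> K"
  shows "m / (K * real CARD('n) ^ 3) powr ((1 + \<beta>) / 2) * V c powr ((1 + \<beta>) / 2)
       \<le> (\<Sum>i\<in>UNIV. \<Sum>j\<in>UNIV. w i j * \<bar>y j - y i\<bar> powr (1 + p i j))"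
proof (cases "V c > 0")
  case False
  then have "V c = 0" by (simp add: V_def order_antisym sum_nonneg)
  then show ?thesis using w by (simp add: sum_nonneg)
next
  case True
  define n where "n = real CARD('n)"
  have n: "n > 0" by (simp add: n_def)
  define z where "z = V c / n ^ 3"
  obtain i j where wji: "w j i > 0" and long: "z \<le> (y j - y i)\<^sup>2"
    using connected_long_edge[OF conn mean] True by (auto simp: V_def z_def n_def)
  have z: "z > 0" using True n by (simp add: z_def)
  have zK: "z / K \<le> 1" using K by (simp only: z_def n_def divide_le_eq_1) simp
  let ?q = "(1 + p j i) / 2"
  have "V c powr ((1 + \<beta>) / 2) / (K * n ^ 3) powr ((1 + \<beta>) / 2) = (z / K) powr ((1 + \<beta>) / 2)"
    using True n K by (simp add: z_def powr_divide[symmetric] mult.commute)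
  also have "\<dots> \<le> (z / K) powr ?q"
    using z zK K p(2)[of j i] by (intro powr_mono') auto
  also have "\<dots> \<le> z powr ?q"
  proof (rule powr_mono2)
    show "z / K \<le> z" using z K by (simp add: divide_le_eq)
  qed (use z K p(1)[of j i] in auto)
  also have "\<dots> \<le> ((y j - y i)\<^sup>2) powr ?q"
    using z long p(1)[of j i] by (intro powr_mono2) auto
  also have "\<dots> = \<bar>y i - y j\<bar> powr (1 + p j i)"
  proof -
    have ne: "\<bar>y i - y j\<bar> > 0" using z long by auto
    have "(y j - y i)\<^sup>2 = \<bar>y i - y j\<bar> powr 2"
      using ne by (simp add: power2_commute)
    then have "(y j - y i)\<^sup>2 powr ?q = \<bar>y i - y j\<bar> powr (2 * ?q)"
      by (simp only: powr_powr)
    also have "2 * ?q = 1 + p j i" by simp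
    finally show ?thesis .
  qed
  finally have "m * (V c powr ((1 + \<beta>) / 2) / (K * n ^ 3) powr ((1 + \<beta>) / 2))
      \<le> w j i * \<bar>y i - y j\<bar> powr (1 + p j i)"
    using w(2)[OF wji] \<open>m \<ge> 0\<close> w(1) by (intro mult_mono) auto
  also have "\<dots> \<le> (\<Sum>k\<in>UNIV. w j k * \<bar>y k - y j\<bar> powr (1 + p j k))"
    using w(1) by (intro member_le_sum) auto
  also have "\<dots> \<le> (\<Sum>l\<in>UNIV. \<Sum>k\<in>UNIV. w l k * \<bar>y k - y l\<bar> powr (1 + p l k))"
    using w(1) by (intro member_le_sum[where f = "\<lambda>l. \<Sum>k\<in>UNIV. w l k * \<bar>y k - y l\<bar> powr (1 + p l k)"])
      (auto intro: sum_nonneg)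
  finally show ?thesis by (simp add: n_def)
qed

section \<open>Switching signals\<close>

lemma piecewise_constant_finite_discontinuities:
  fixes f :: "real \<Rightarrow> real"
  assumes "piecewise_constant f"
  shows "finite {t \<in> {0<..<T}. \<not> isCont f t}"
proof (cases "T \<ge> 0")
  case False
  then show ?thesis by simp
next
  case True
  then obtain S where S: "finite S" and
    const: "\<And>s t. 0 \<le> s \<Longrightarrow> t \<le> T \<Longrightarrow> {s<..<t} \<inter> S = {} \<Longrightarrow> f constant_on {s<..<t}"
    using assms unfolding piecewise_constant_def by metis
  have "isCont f t" if t: "t \<in> {0<..<T} - S" for t
  proof -
    have "open ({0<..<T} - S)" using S by (simp add: open_Diff finite_imp_closed)
    then obtain e where e: "e > 0" "ball t e \<subseteq> {0<..<T} - S"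
      using t by (meson open_contains_ball)
    have ball: "ball t e = {t - e<..<t + e}" by (rule ball_eq_greaterThanLessThan)
    have "0 \<le> t - e" "t + e \<le> T"
      using e ball by (auto simp: greaterThanLessThan_subseteq_greaterThanLessThan
          dest: order_trans[OF _ Diff_subset])
    then have "f constant_on {t - e<..<t + e}"
      using e ball by (intro const) auto
    then obtain k where "\<And>s. s \<in> {t - e<..<t + e} \<Longrightarrow> f s = k"
      by (auto simp: constant_on_def)
    then have "continuous_on {t - e<..<t + e} f"
      by (metis continuous_on_cong continuous_on_const)
    then show ?thesis
      using e(1) by (simp add: continuous_on_eq_continuous_at)
  qed
  then show ?thesis
    by (intro finite_subset[OF _ S]) auto
qed

lemma finite_switching_times:
  fixes a \<alpha> :: "'n::finite \<Rightarrow> 'n \<Rightarrow> real \<Rightarrow> real"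
  assumes "\<And>i j. switching_signal (a i j)" "\<And>i j. switching_signal (\<alpha> i j)"
  shows "finite ({0<..<T} \<inter> switching_times a \<alpha>)"
proof -
  have "piecewise_constant (a i j)" "piecewise_constant (\<alpha> i j)" for i j
    using assms by (simp_all add: switching_signal_def)
  then have "finite (\<Union>i. \<Union>j. {t \<in> {0<..<T}. \<not> isCont (a i j) t} \<union> {t \<in> {0<..<T}. \<not> isCont (\<alpha> i j) t})"
    by (intro finite_UN_I finite_UnI piecewise_constant_finite_discontinuities finite)
  moreover have "{0<..<T} \<inter> switching_times a \<alpha> \<subseteq>
      (\<Union>i. \<Union>j. {t \<in> {0<..<T}. \<not> isCont (a i j) t} \<union> {t \<in> {0<..<T}. \<not> isCont (\<alpha> i j) t})"
    unfolding switching_times_def by blast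
  ultimately show ?thesis by (rule finite_subset[rotated])
qed

text \<open>
  Away from the switching times, the equation holds near \<open>t\<close> with the coefficients of a slightly
  earlier time \<open>s\<close>.  Since the assumptions on the coefficients hold at every time, the
  conclusion only has to provide some \<open>s \<ge> 0\<close>.
\<close>

lemma consensus_solution_derivative:
  fixes a \<alpha> :: "'n::finite \<Rightarrow> 'n \<Rightarrow> real \<Rightarrow> real"
  assumes sol: "consensus_solution a \<alpha> x"
    and fin: "finite ({0<..<T} \<inter> switching_times a \<alpha>)"
    and t: "t \<in> {0<..<T} - switching_times a \<alpha>"
  shows "\<exists>s\<ge>0. \<forall>i. ((\<lambda>u. x u $ i) has_real_derivative
    (\<Sum>j\<in>UNIV. a i j s * sig (x t $ j - x t $ i) (\<alpha> i j s))) (at t)"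
proof -
  have "{0<..<T} - switching_times a \<alpha> = {0<..<T} - ({0<..<T} \<inter> switching_times a \<alpha>)"
    by blast
  then have "open ({0<..<T} - switching_times a \<alpha>)"
    using fin by (simp only: open_Diff finite_imp_closed open_greaterThanLessThan)
  then obtain e where e: "e > 0" "cball t e \<subseteq> {0<..<T} - switching_times a \<alpha>"
    using t by (meson open_contains_cball)
  define s where "s = t - e"
  have ball: "cball t e = {s..t + e}" by (simp add: cball_eq_atLeastAtMost s_def)
  have s: "0 \<le> s" "s < t + e" "t \<in> {s<..<t + e}"
    using e ball by (auto simp: s_def dest: subsetD[of _ _ "t - e"])
  have "{s<..<t + e} \<inter> switching_times a \<alpha> = {}" using e ball by auto
  then have "(x has_vector_derivative consensus_field (\<lambda>i j. a i j s) (\<lambda>i j. \<alpha> i j s) (x t))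
      (at t within {s..t + e})"
    using sol s by (auto simp: consensus_solution_def)
  then have "(x has_vector_derivative consensus_field (\<lambda>i j. a i j s) (\<lambda>i j. \<alpha> i j s) (x t)) (at t)"
    using s(3) by (simp add: at_within_Icc_at)
  then have "((\<lambda>u. x u $ i) has_real_derivative
      consensus_field (\<lambda>i j. a i j s) (\<lambda>i j. \<alpha> i j s) (x t) $ i) (at t)" for i
    unfolding has_real_derivative_iff_has_vector_derivative
    by (rule bounded_linear.has_vector_derivative[OF bounded_linear_vec_nth])
  then show ?thesis using s(1) by (auto simp: consensus_field_def)
qed

lemma finite_switching_signal_values:
  fixes f :: "'n::finite \<Rightarrow> 'n \<Rightarrow> real \<Rightarrow> real"
  assumes "\<And>i j. switching_signal (f i j)"
  shows "finite {f i j t |i j t. t \<ge> 0}"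
proof -
  have "{f i j t |i j t. t \<ge> 0} = (\<Union>i j. f i j ` {0..})" by auto
  then show ?thesis using assms by (simp add: switching_signal_def)
qed

theorem theorem7:
  fixes a \<alpha> :: "'n::finite \<Rightarrow> 'n \<Rightarrow> real \<Rightarrow> real"
  assumes "\<And>i j. switching_signal (a i j)"
    and "\<And>i j t. t \<ge> 0 \<Longrightarrow> a i j t \<ge> 0"
    and "\<And>i t. t \<ge> 0 \<Longrightarrow> a i i t = 0"
    and "\<And>t. t \<ge> 0 \<Longrightarrow> undirected_matrix_digraph (\<chi> i j. a i j t)"
    and "\<And>t. t \<ge> 0 \<Longrightarrow> path_connected_digraph (matrix_digraph (\<chi> i j. a i j t))"
    and "\<And>i j. switching_signal (\<alpha> i j)"
    and "\<And>i j t. t \<ge> 0 \<Longrightarrow> \<alpha> i j t = \<alpha> j i t"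
    and "\<And>i j t. t \<ge> 0 \<Longrightarrow> 0 < \<alpha> i j t \<and> \<alpha> i j t < 1"
  shows "solves_finite_time_average_consensus a \<alpha>"
  unfolding solves_finite_time_average_consensus_def
proof (intro allI impI, elim conjE)
  fix x0 :: "real ^ 'n" and x
  assume sol: "consensus_solution a \<alpha> x" and init: "x 0 = x0"
  have sym: "a i j t = a j i t" if "t \<ge> 0" for i j t
    using assms(4)[OF that] by (simp add: undirected_matrix_digraph_def transpose_def vec_eq_iff)
  \<comment> \<open>A graph with a single vertex has no positive weights; the inserted \<open>1\<close> keeps the minimum
     meaningful.  The inserted \<open>1 / 2\<close> makes it evident that \<open>\<beta>\<close> is positive.\<close>
  define m where "m = Min (insert 1 ({a i j t |i j t. t \<ge> 0} \<inter> {0<..}))"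
  define \<beta> where "\<beta> = Max (insert (1/2) {\<alpha> i j t |i j t. t \<ge> 0})"
  have finA: "finite (insert 1 ({a i j t |i j t. t \<ge> 0} \<inter> {0<..}))"
    using finite_switching_signal_values[of a] assms(1) by blast
  have finB: "finite (insert (1/2) {\<alpha> i j t |i j t. t \<ge> 0})"
    using finite_switching_signal_values[of \<alpha>] assms(6) by blast
  have m: "m > 0" using finA unfolding m_def by (subst Min_gr_iff) auto
  have a_ge: "a i j t \<ge> m" if "t \<ge> 0" "a i j t > 0" for i j t
    unfolding m_def using finA that by (intro Min_le) auto
  have \<beta>: "0 < \<beta>" "\<beta> < 1"
    using finB assms(8) unfolding \<beta>_def by (auto simp: Max_gr_iff Max_less_iff)
  have \<alpha>_le: "\<alpha> i j t \<le> \<beta>" if "t \<ge> 0" for i j t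
    unfolding \<beta>_def using finB that by (intro Max_ge) auto
  define n where "n = real CARD('n)"
  have n: "n > 0" by (simp add: n_def)
  define c where "c = (\<Sum>i\<in>UNIV. x0 $ i) / n"
  define V where "V t = (\<Sum>i\<in>UNIV. (x t $ i - c)\<^sup>2)" for t
  have comp_cont: "continuous_on {0..} (\<lambda>t. x t $ i)" for i
    using sol by (auto simp: consensus_solution_def intro: continuous_intros)
  have V_cont: "continuous_on {0..} V"
    unfolding V_def by (intro continuous_intros comp_cont)
  let ?Sw = "switching_times a \<alpha>"
  have fin: "finite ({0<..<T} \<inter> ?Sw)" for T
    by (rule finite_switching_times) (use assms in auto)
  let ?E = "\<lambda>s t. \<Sum>i\<in>UNIV. \<Sum>j\<in>UNIV. a i j s * \<bar>x t $ j - x t $ i\<bar> powr (1 + \<alpha> i j s)"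
  have derivs: "\<exists>s\<ge>0. ((\<lambda>u. \<Sum>i\<in>UNIV. x u $ i) has_real_derivative 0) (at t)
      \<and> (V has_real_derivative - ?E s t) (at t)" if "t > 0" "t \<notin> ?Sw" for t
  proof -
    let ?F = "\<lambda>s i. \<Sum>j\<in>UNIV. a i j s * sig (x t $ j - x t $ i) (\<alpha> i j s)"
    have "t \<in> {0<..<t + 1} - ?Sw" using that by simp
    from consensus_solution_derivative[OF sol fin this]
    obtain s where s: "s \<ge> 0" and D: "\<And>i. ((\<lambda>u. x u $ i) has_real_derivative ?F s i) (at t)"
      by blast
    have S: "((\<lambda>u. \<Sum>i\<in>UNIV. x u $ i) has_real_derivative (\<Sum>i\<in>UNIV. ?F s i)) (at t)"
      by (intro DERIV_sum D)
    have "(V has_real_derivative (\<Sum>i\<in>UNIV. 2 * (x t $ i - c) * ?F s i)) (at t)"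
      unfolding V_def
      by (intro DERIV_sum) (rule derivative_eq_intros D | simp)+
    with S s show ?thesis
      using disagreement_dissipation[of "\<lambda>i j. a i j s" "\<lambda>i j. \<alpha> i j s", OF sym assms(7)] by auto
  qed
  have mean: "(\<Sum>i\<in>UNIV. x t $ i) = n * c" if t: "t \<ge> 0" for t
  proof -
    let ?f = "\<lambda>t. \<Sum>i\<in>UNIV. x t $ i"
    have cont: "continuous_on {0..t} ?f"
      by (intro continuous_intros continuous_on_subset[OF comp_cont]) auto
    have D: "(?f has_real_derivative 0) (at u)" if "u \<in> {0<..<t} - ({0<..<t} \<inter> ?Sw)" for u
      using derivs[of u] that by auto
    have "?f t \<le> ?f 0"
      by (rule nonincreasing_except_finite[OF t cont fin]) (use D in blast)
    moreover have "- ?f t \<le> - ?f 0"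
    proof (rule nonincreasing_except_finite[OF t _ fin])
      show "\<exists>d\<le>0. ((\<lambda>u. - ?f u) has_real_derivative d) (at u)"
        if "u \<in> {0<..<t} - ({0<..<t} \<inter> ?Sw)" for u
        using DERIV_minus[OF D[OF that]] by auto
    qed (intro continuous_intros cont)
    ultimately show ?thesis using n init by (simp add: c_def)
  qed
  have V_mono: "V t \<le> V s" if "0 \<le> s" "s \<le> t" for s t
  proof (rule nonincreasing_except_finite[OF that(2) _ fin[of t]])
    show "continuous_on {s..t} V" by (rule continuous_on_subset[OF V_cont]) (use that in auto)
  next
    fix u assume "u \<in> {s<..<t} - ({0<..<t} \<inter> ?Sw)"
    then have "u > 0" "u \<notin> ?Sw" using that by auto
    from derivs[OF this]
    obtain r where "r \<ge> 0" and D: "(V has_real_derivative - ?E r u) (at u)"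
      by blast
    have "?E r u \<ge> 0" using assms(2)[OF \<open>r \<ge> 0\<close>] by (intro sum_nonneg) auto
    then have "- ?E r u \<le> 0" by simp
    with D show "\<exists>D\<le>0. (V has_real_derivative D) (at u)" by blast
  qed
  define K where "K = max 1 (V 0 / n ^ 3)"
  define C where "C = m / (K * n ^ 3) powr ((1 + \<beta>) / 2)"
  have decay: "C * V t powr ((1 + \<beta>) / 2) \<le> ?E s t" if "t \<ge> 0" "s \<ge> 0" for s t
    unfolding C_def V_def n_def
  proof (rule disagreement_decay)
    show "(\<Sum>i\<in>UNIV. x t $ i) = real CARD('n) * c" using mean[OF that(1)] by (simp add: n_def)
    have "V t / n ^ 3 \<le> V 0 / n ^ 3" using V_mono[of 0 t] that n by (simp add: divide_right_mono)
    then show "(\<Sum>i\<in>UNIV. (x t $ i - c)\<^sup>2) / real CARD('n) ^ 3 \<le> K"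
      by (simp add: K_def V_def n_def)
  qed (use assms(2,5,8) a_ge \<alpha>_le that m in \<open>auto simp: K_def\<close>)
  have "\<exists>t'\<ge>0. \<forall>t\<ge>t'. V t = 0"
  proof (rule finite_time_extinction[OF V_cont _ V_mono, where C = C and \<theta> = "(1 + \<beta>) / 2"])
    have "K > 0" by (simp add: K_def)
    then show "C > 0" using m n by (simp add: C_def)
    show "\<exists>S. finite S \<and> (\<forall>t\<in>{0<..<T} - S. \<exists>D. (V has_real_derivative D) (at t)
        \<and> D \<le> - C * V t powr ((1 + \<beta>) / 2))" for T
    proof (rule exI[of _ "{0<..<T} \<inter> ?Sw"], intro conjI ballI)
      show "finite ({0<..<T} \<inter> ?Sw)" by (rule fin)
    next
      fix t assume t: "t \<in> {0<..<T} - ({0<..<T} \<inter> ?Sw)"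
      then have "t > 0" "t \<notin> ?Sw" by auto
      from derivs[OF this]
      obtain s where s: "s \<ge> 0" and D: "(V has_real_derivative - ?E s t) (at t)" by blast
      have "- ?E s t \<le> - C * V t powr ((1 + \<beta>) / 2)"
        using decay[of t s] s \<open>t > 0\<close> by simp
      with D show "\<exists>D. (V has_real_derivative D) (at t) \<and> D \<le> - C * V t powr ((1 + \<beta>) / 2)"
        by blast
    qed
  qed (use \<beta> in \<open>auto simp: V_def sum_nonneg\<close>)
  then obtain t' where t': "t' \<ge> 0" "\<And>t. t \<ge> t' \<Longrightarrow> V t = 0" by blast
  have "x t $ j = c" if "t \<ge> t'" for t j
    using t'(2)[OF that] by (simp add: V_def sum_nonneg_eq_0_iff)
  then show "\<exists>t'\<ge>0. \<forall>t\<ge>t'. \<forall>j. x t $ j = (\<Sum>i\<in>UNIV. x0 $ i) / real CARD('n)"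
    using t'(1) by (auto simp: c_def n_def)
qed

end
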